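(* Let $\zeta$ be the Riemann zeta function and $s=\sigma+it$ with $\sigma,t$ real, $0<\sigma\le2$ and $t\ge2$. Then $$|\zeta(s)|\le 1+\frac{t}{\sigma}.$$ *)

theory Defs
  imports "HOL-Complex_Analysis.Complex_Analysis"
begin

text \<open>
  The Riemann zeta function: the analytic continuation to the punctured plane of the Dirichlet
  series that defines it for real part greater than 1. The value at the pole is fixed by
  convention. Existence and uniqueness are established by \<open>zeta_characterization_ex1\<close> below.
\<close>

definition zeta :: "complex \<Rightarrow> complex" where
  "zeta = (THE f. f holomorphic_on (- {1}) \<and>
                  (\<forall>s. Re s > 1 \<longrightarrow> f s = (\<Sum>n. 1 / of_nat (Suc n) powr s)) \<and>
                  f 1 = 0)"

lemma norm_gbinomial_le:
  fixes a :: complex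
  assumes "norm a \<le> R"
  shows "norm (a gchoose k) \<le> (- R gchoose k) * (- 1) ^ k"
proof -
  have R: "R \<ge> 0" using assms norm_ge_zero[of a] by linarith
  have "norm (pochhammer (- a) k) \<le> pochhammer R k"
    unfolding pochhammer_prod
  proof -
    have "norm (\<Prod>i = 0..<k. - a + of_nat i) = (\<Prod>i = 0..<k. norm (- a + of_nat i))"
      by (simp add: prod_norm)
    also have "\<dots> \<le> (\<Prod>i = 0..<k. R + real i)"
    proof (rule prod_mono, safe)
      fix i
      show "norm (- a + of_nat i) \<le> R + real i"
        using norm_triangle_ineq[of "- a" "of_nat i"] assms by simp
    qed auto
    finally show "norm (\<Prod>i = 0..<k. - a + of_nat i) \<le> (\<Prod>i = 0..<k. R + of_nat i)" by simp
  qed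
  hence "norm (pochhammer (- a) k) / fact k \<le> pochhammer R k / fact k"
    by (intro divide_right_mono) auto
  moreover have "norm (a gchoose k) = norm (pochhammer (- a) k) / fact k"
    by (simp add: gbinomial_pochhammer norm_mult norm_divide norm_power)
  moreover have "(- R gchoose k) * (- 1) ^ k = pochhammer R k / fact k"
  proof -
    have "((- 1) ^ k * (- 1) ^ k :: real) = 1" by (simp flip: power_mult_distrib)
    thus ?thesis by (simp add: gbinomial_pochhammer)
  qed
  ultimately show ?thesis by simp
qed

lemma binomial_remainder_bound:
  fixes R :: real
  obtains C where "\<And>a z :: complex. norm a \<le> R \<Longrightarrow> norm z \<le> 1 / 2 \<Longrightarrow>
    norm ((1 + z) powr a - (\<Sum>k<m. (a gchoose k) * z ^ k)) \<le> C * norm z ^ m"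
proof -
  define B where "B k = (- R gchoose k) * (- 1) ^ k" for k
  have "(\<lambda>k. (- R gchoose k) * (- 1 / 2) ^ k) sums (1 + (- 1 / 2)) powr (- R)"
    by (rule gen_binomial_real) simp
  hence "summable (\<lambda>k. (- R gchoose k) * (- 1 / 2) ^ k)" by (rule sums_summable)
  also have "(\<lambda>k. (- R gchoose k) * (- 1 / 2) ^ k) = (\<lambda>k. B k * (1 / 2) ^ k)"
    unfolding B_def mult.assoc power_mult_distrib[symmetric] by simp
  finally have sB: "summable (\<lambda>k. B (k + m) * (1 / 2) ^ (k + m))"
    by (rule summable_ignore_initial_segment)
  have sB': "summable (\<lambda>k. 2 ^ m * (B (k + m) * (1 / 2) ^ (k + m)))"
    by (rule summable_mult[OF sB])
  define C where "C = (\<Sum>k. 2 ^ m * (B (k + m) * (1 / 2) ^ (k + m)))"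
  show ?thesis
  proof (rule that[of C])
    fix a z :: complex
    assume a: "norm a \<le> R" and z: "norm z \<le> 1 / 2"
    have "(\<lambda>k. (a gchoose k) * z ^ k) sums (1 + z) powr a"
      by (rule gen_binomial_complex) (use z in simp)
    hence sums: "(\<lambda>k. (a gchoose (k + m)) * z ^ (k + m)) sums
        ((1 + z) powr a - (\<Sum>k<m. (a gchoose k) * z ^ k))"
      by (subst sums_iff_shift) simp
    have bd: "norm ((a gchoose (k + m)) * z ^ (k + m))
        \<le> 2 ^ m * (B (k + m) * (1 / 2) ^ (k + m)) * norm z ^ m" for k
    proof -
      have n: "norm (a gchoose (k + m)) \<le> B (k + m)"
        unfolding B_def by (rule norm_gbinomial_le[OF a])
      have "norm ((a gchoose (k + m)) * z ^ (k + m)) = norm (a gchoose (k + m)) * norm z ^ k * norm z ^ m"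
        by (simp add: norm_mult norm_power power_add)
      also have "\<dots> \<le> B (k + m) * (1 / 2) ^ k * norm z ^ m"
        using n z order_trans[OF norm_ge_zero n]
        by (intro mult_right_mono mult_mono power_mono) auto
      also have "\<dots> = 2 ^ m * (B (k + m) * (1 / 2) ^ (k + m)) * norm z ^ m"
        by (simp add: power_add power_divide)
      finally show ?thesis .
    qed
    have "norm (\<Sum>k. (a gchoose (k + m)) * z ^ (k + m))
        \<le> (\<Sum>k. 2 ^ m * (B (k + m) * (1 / 2) ^ (k + m)) * norm z ^ m)"
      by (rule norm_suminf_le[OF bd]) (rule summable_mult2[OF sB'])
    also have "\<dots> = C * norm z ^ m"
      unfolding C_def by (rule suminf_mult2[symmetric, OF sB'])
    finally show "norm ((1 + z) powr a - (\<Sum>k<m. (a gchoose k) * z ^ k)) \<le> C * norm z ^ m"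
      using sums by (simp add: sums_iff)
  qed
qed

lemma summable_nat_powr:
  assumes "Re s > 1"
  shows "summable (\<lambda>n. of_nat (n + 2) powr (- s) :: complex)"
proof (rule summable_comparison_test')
  have "summable (\<lambda>n. real n powr (- Re s))"
    using assms by (simp add: summable_real_powr_iff)
  thus "summable (\<lambda>n. real (n + 2) powr (- Re s))"
    by (rule summable_ignore_initial_segment)
  show "norm (of_nat (n + 2) powr (- s) :: complex) \<le> real (n + 2) powr (- Re s)" if "n \<ge> 0" for n
    using norm_powr_real_powr[of "of_nat (n + 2)" "- s"] by simp
qed

text \<open>
  With \<open>D s = (\<Sum>n\<ge>2. n powr (- s))\<close>, Taylor expansion of the telescoping differences
  \<open>(n - 1) powr (1 - s) - n powr (1 - s)\<close> relates \<open>(s - 1) * D s\<close> to the values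
  \<open>D (s + 1), D (s + 2), \<dots>\<close> and an error term that is holomorphic further to the left.
\<close>

definition zeta_tail :: "complex \<Rightarrow> complex" where
  "zeta_tail s = (\<Sum>n. of_nat (n + 2) powr (- s))"

definition zeta_rem_term :: "nat \<Rightarrow> nat \<Rightarrow> complex \<Rightarrow> complex" where
  "zeta_rem_term m n s = of_nat (n + 1) powr (1 - s) -
     (\<Sum>k<m. (1 - s gchoose k) * (- 1) ^ k * of_nat (n + 2) powr (1 - s - of_nat k))"

lemma zeta_rem_term_eq:
  "zeta_rem_term m n s = of_nat (n + 2) powr (1 - s) *
     ((1 + (- 1 / of_nat (n + 2))) powr (1 - s) -
       (\<Sum>k<m. (1 - s gchoose k) * (- 1 / of_nat (n + 2)) ^ k))"
proof -
  define x :: real where "x = real (n + 2)"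
  have x: "x > 1" and xc: "complex_of_real x = of_nat (n + 2)" by (auto simp: x_def)
  have "complex_of_real x powr (1 - s) * complex_of_real (1 - 1 / x) powr (1 - s)
      = complex_of_real (x * (1 - 1 / x)) powr (1 - s)"
    unfolding of_real_mult using x by (subst powr_times_real) auto
  also have "x * (1 - 1 / x) = real (n + 1)"
    using x by (simp add: field_simps x_def)
  finally have 1: "of_nat (n + 2) powr (1 - s) * (1 + (- 1 / of_nat (n + 2))) powr (1 - s)
      = (of_nat (n + 1) powr (1 - s) :: complex)"
    by (simp only: of_real_diff of_real_divide of_real_1 xc of_real_of_nat_eq
                   minus_divide_left [symmetric] diff_conv_add_uminus [of 1 "1 / of_nat (n + 2)"])
  have 2: "(of_nat (n + 2) powr (1 - s - of_nat k) :: complex)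
      = of_nat (n + 2) powr (1 - s) / of_nat (n + 2) ^ k" for k
  proof -
    have "of_nat (n + 2) \<noteq> (0 :: complex)" unfolding of_nat_eq_0_iff by simp
    thus ?thesis by (simp only: powr_diff powr_nat if_False)
  qed
  show ?thesis
    unfolding zeta_rem_term_def 2 right_diff_distrib 1 sum_distrib_left
    by (intro arg_cong2[where f = "(-)"] sum.cong refl)
       (simp only: power_divide mult_ac times_divide_eq_left times_divide_eq_right)
qed

lemma zeta_rem_holomorphic:
  assumes "m \<ge> 1"
  shows "(\<lambda>s. \<Sum>n. zeta_rem_term m n s) holomorphic_on {s. Re s > 2 - real m}"
proof (rule holomorphic_uniform_sequence[where f = "\<lambda>N s. \<Sum>n<N. zeta_rem_term m n s"])
  show "open {s. Re s > 2 - real m}" by (rule open_halfspace_Re_gt)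
  have gb: "(\<lambda>s. (1 - s gchoose k)) holomorphic_on A" for k A
    unfolding gbinomial_prod_rev by (intro holomorphic_intros) auto
  show "(\<lambda>s. \<Sum>n<N. zeta_rem_term m n s) holomorphic_on {s. Re s > 2 - real m}" for N
    unfolding zeta_rem_term_def
    by (intro holomorphic_intros gb)
next
  fix x assume x: "x \<in> {s. Re s > 2 - real m}"
  define d where "d = (Re x - (2 - real m)) / 2"
  define r where "r = Re x - d"
  have d: "d > 0" and r: "r > 2 - real m" using x by (auto simp: d_def r_def field_simps)
  obtain C where C: "\<And>a z :: complex. norm a \<le> 1 + norm x + d \<Longrightarrow> norm z \<le> 1 / 2 \<Longrightarrow>
      norm ((1 + z) powr a - (\<Sum>k<m. (a gchoose k) * z ^ k)) \<le> C * norm z ^ m"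
    using binomial_remainder_bound[of "1 + norm x + d" m] by blast
  have Re: "Re s \<ge> r" if "s \<in> cball x d" for s
    using that abs_Re_le_cmod[of "x - s"] by (auto simp: r_def dist_norm)
  have "uniform_limit (cball x d) (\<lambda>N s. \<Sum>n<N. zeta_rem_term m n s)
          (\<lambda>s. \<Sum>n. zeta_rem_term m n s) sequentially"
  proof (rule Weierstrass_m_test)
    fix n s assume s: "s \<in> cball x d"
    define y where "y = real (n + 2)"
    have y: "y \<ge> 2" by (simp add: y_def)
    have n1: "norm (of_nat (n + 2) powr (1 - s)) = y powr (1 - Re s)"
      using norm_powr_real_powr[of "of_nat (n + 2)" "1 - s"] by (simp add: y_def)
    have n2: "norm (- 1 / of_nat (n + 2) :: complex) = 1 / y"
      unfolding norm_divide norm_of_nat y_def by simp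
    have "norm (1 - s) \<le> 1 + norm x + d"
      using s norm_triangle_ineq4[of 1 s] norm_triangle_ineq2[of s x]
      by (auto simp: dist_norm norm_minus_commute)
    hence n3: "norm ((1 + (- 1 / of_nat (n + 2))) powr (1 - s) -
        (\<Sum>k<m. (1 - s gchoose k) * (- 1 / of_nat (n + 2)) ^ k)) \<le> C * (1 / y) ^ m"
      using C[of "1 - s" "- 1 / of_nat (n + 2)"] y unfolding n2 by (simp add: field_simps)
    hence C0: "C * (1 / y) ^ m \<ge> 0" by (rule order_trans[OF norm_ge_zero])
    have "norm (zeta_rem_term m n s) \<le> y powr (1 - Re s) * (C * (1 / y) ^ m)"
      unfolding zeta_rem_term_eq norm_mult n1 by (intro mult_left_mono n3) simp
    also have "\<dots> \<le> y powr (1 - r) * (C * (1 / y) ^ m)"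
      using y C0 Re[OF s] by (intro mult_right_mono powr_mono) auto
    also have "\<dots> = C * y powr (1 - r - real m)"
      using y by (simp add: powr_diff powr_realpow power_divide)
    finally show "norm (zeta_rem_term m n s) \<le> C * real (n + 2) powr (1 - r - real m)"
      by (simp add: y_def)
  next
    have "summable (\<lambda>n. real n powr (1 - r - real m))"
      using r by (simp add: summable_real_powr_iff)
    thus "summable (\<lambda>n. C * real (n + 2) powr (1 - r - real m))"
      by (intro summable_mult summable_ignore_initial_segment)
  qed
  moreover have "cball x d \<subseteq> {s. Re s > 2 - real m}"
    using Re r by force
  ultimately show "\<exists>d>0. cball x d \<subseteq> {s. Re s > 2 - real m} \<and>
      uniform_limit (cball x d) (\<lambda>N s. \<Sum>n<N. zeta_rem_term m n s)
          (\<lambda>s. \<Sum>n. zeta_rem_term m n s) sequentially"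
    using d by blast
qed

lemma zeta_rem_eq:
  assumes "Re s > 1"
  shows "(\<Sum>n. zeta_rem_term (m + 2) n s) =
    1 - (s - 1) * zeta_tail s -
    (\<Sum>k<m. (1 - s gchoose (k + 2)) * (- 1) ^ k * zeta_tail (s + of_nat k + 1))"
proof -
  have lim: "(\<lambda>n. of_nat (n + 1) powr (1 - s) :: complex) \<longlonglongrightarrow> 0"
  proof (rule tendsto_norm_zero_cancel)
    have "(\<lambda>n. real (n + 1) powr (1 - Re s)) \<longlonglongrightarrow> 0"
      using assms by real_asymp
    also have "(\<lambda>n. real (n + 1) powr (1 - Re s))
        = (\<lambda>n. norm (of_nat (n + 1) powr (1 - s) :: complex))"
      using norm_powr_real_powr[of "of_nat (n + 1)" "1 - s" for n] by (simp add: fun_eq_iff)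
    finally show "\<dots> \<longlonglongrightarrow> 0" .
  qed
  have tele: "(\<lambda>n. of_nat (n + 1) powr (1 - s) - of_nat (n + 2) powr (1 - s) :: complex) sums 1"
    using telescope_sums'[OF lim] by (simp add: add_ac)
  have tail: "(\<lambda>n. of_nat (n + 2) powr (- z)) sums zeta_tail z" if "Re z > 1" for z
    unfolding zeta_tail_def by (rule summable_sums[OF summable_nat_powr[OF that]])
  have "(\<lambda>n. (of_nat (n + 1) powr (1 - s) - of_nat (n + 2) powr (1 - s)) -
          (s - 1) * of_nat (n + 2) powr (- s) -
          (\<Sum>k<m. (1 - s gchoose (k + 2)) * (- 1) ^ k * of_nat (n + 2) powr (- (s + of_nat k + 1))))
      sums (1 - (s - 1) * zeta_tail s -
          (\<Sum>k<m. (1 - s gchoose (k + 2)) * (- 1) ^ k * zeta_tail (s + of_nat k + 1)))"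
    using assms by (intro sums_diff sums_sum sums_mult tele tail) auto
  also have "(\<lambda>n. (of_nat (n + 1) powr (1 - s) - of_nat (n + 2) powr (1 - s)) -
          (s - 1) * of_nat (n + 2) powr (- s) -
          (\<Sum>k<m. (1 - s gchoose (k + 2)) * (- 1) ^ k * of_nat (n + 2) powr (- (s + of_nat k + 1))))
      = (\<lambda>n. zeta_rem_term (m + 2) n s)"
  proof
    fix n
    have e: "- (s + of_nat k + 1) = 1 - s - of_nat (k + 2)" for k by simp
    have e1: "1 - (s + of_nat (Suc 0)) = - s" by simp
    have split: "(\<Sum>k<m + 2. f k) = f 0 + f 1 + (\<Sum>k<m. f (k + 2))" for f :: "nat \<Rightarrow> complex"
      by (simp add: sum.lessThan_Suc_shift del: sum.lessThan_Suc)
    show "(of_nat (n + 1) powr (1 - s) - of_nat (n + 2) powr (1 - s)) -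
          (s - 1) * of_nat (n + 2) powr (- s) -
          (\<Sum>k<m. (1 - s gchoose (k + 2)) * (- 1) ^ k * of_nat (n + 2) powr (- (s + of_nat k + 1)))
        = zeta_rem_term (m + 2) n s"
      unfolding zeta_rem_term_def split e
      by (simp add: e1 algebra_simps del: of_nat_Suc)
  qed
  finally show ?thesis by (simp add: sums_iff)
qed

lemma zeta_tail_continuation:
  "\<exists>H. H holomorphic_on {s. Re s > 1 - real N} \<and> (\<forall>s. Re s > 1 \<longrightarrow> H s = (s - 1) * zeta_tail s)"
proof (induction N)
  case 0
  have "(\<lambda>s. 1 - (\<Sum>n. zeta_rem_term 2 n s)) holomorphic_on {s. Re s > 0}"
    using zeta_rem_holomorphic[of 2] by (intro holomorphic_intros) simp
  hence "(\<lambda>s. 1 - (\<Sum>n. zeta_rem_term 2 n s)) holomorphic_on {s. Re s > 1 - real 0}"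
    by (rule holomorphic_on_subset) auto
  thus ?case
    using zeta_rem_eq[of _ 0] by (intro exI[of _ "\<lambda>s. 1 - (\<Sum>n. zeta_rem_term 2 n s)"]) (auto simp: numeral_2_eq_2)
next
  case (Suc N)
  then obtain H where H: "H holomorphic_on {s. Re s > 1 - real N}"
    and HD: "\<And>s. Re s > 1 \<Longrightarrow> H s = (s - 1) * zeta_tail s" by blast
  define c where "c k s = - pochhammer (s - 1) (k + 1) / fact (k + 2)" for k and s :: complex
  define G where "G s = 1 - (\<Sum>n. zeta_rem_term (N + 2) n s)
      + (\<Sum>k<N. c k s * H (s + of_nat k + 1))" for s
  have c: "c k s * (s + of_nat k) = - ((1 - s gchoose (k + 2)) * (- 1) ^ k)" for k s
  proof -
    have "((- 1) ^ k * (- 1) ^ k :: complex) = 1" by (simp flip: power_mult_distrib)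
    thus ?thesis
      by (simp add: c_def gbinomial_pochhammer pochhammer_Suc add_ac)
  qed
  have "G holomorphic_on {s. Re s > 1 - real (Suc N)}"
  proof -
    have "(\<lambda>s. \<Sum>n. zeta_rem_term (N + 2) n s) holomorphic_on {s. Re s > 1 - real (Suc N)}"
      using zeta_rem_holomorphic[of "N + 2"] by (rule holomorphic_on_subset) auto
    moreover have "(\<lambda>s. H (s + of_nat k + 1)) holomorphic_on {s. Re s > 1 - real (Suc N)}" for k
    proof -
      have "(H \<circ> (\<lambda>s. s + of_nat k + 1)) holomorphic_on {s. Re s > 1 - real (Suc N)}"
        by (rule holomorphic_on_compose_gen[OF _ H]) (auto intro!: holomorphic_intros)
      thus ?thesis by (simp add: o_def)
    qed
    moreover have "c k holomorphic_on A" for k A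
      unfolding c_def pochhammer_prod by (intro holomorphic_intros) auto
    ultimately show ?thesis
      unfolding G_def by (intro holomorphic_intros)
  qed
  moreover have "G s = (s - 1) * zeta_tail s" if "Re s > 1" for s
  proof -
    have "(\<Sum>k<N. c k s * H (s + of_nat k + 1))
        = (\<Sum>k<N. c k s * (s + of_nat k) * zeta_tail (s + of_nat k + 1))"
      using that by (intro sum.cong refl) (simp add: HD mult.assoc)
    also have "\<dots> = - (\<Sum>k<N. (1 - s gchoose (k + 2)) * (- 1) ^ k * zeta_tail (s + of_nat k + 1))"
      by (simp only: c minus_mult_left[symmetric] sum_negf)
    finally show ?thesis
      unfolding G_def zeta_rem_eq[OF that] by simp
  qed
  ultimately show ?case by blast
qed

lemma zeta_tail_entire:
  obtains H where "H holomorphic_on UNIV" "\<And>s. Re s > 1 \<Longrightarrow> H s = (s - 1) * zeta_tail s"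
proof -
  define A where "A N = {s. Re s > 1 - real N}" for N
  obtain F where F: "\<And>N. F N holomorphic_on A N"
    and FD: "\<And>N s. Re s > 1 \<Longrightarrow> F N s = (s - 1) * zeta_tail s"
    using zeta_tail_continuation unfolding A_def by metis
  have A: "open (A N)" "connected (A N)" for N
    unfolding A_def by (simp_all add: open_halfspace_Re_gt convex_connected convex_halfspace_Re_gt)
  have eq: "F M s = F N s" if "N \<le> M" "s \<in> A N" for M N s
  proof (rule analytic_continuation_open[of "{s. Re s > 1}" "A N" "F M" "F N"])
    show "{s. Re s > 1} \<noteq> {}" by (auto intro: exI[of _ 2])
    show "F M holomorphic_on A N"
      by (rule holomorphic_on_subset[OF F]) (use that in \<open>auto simp: A_def\<close>)
  qed (use that A F FD in \<open>auto simp: A_def open_halfspace_Re_gt\<close>)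
  define H where "H s = F (nat \<lceil>1 - Re s\<rceil> + 1) s" for s
  have H: "H s = F N s" if "s \<in> A N" for s N
  proof -
    have "s \<in> A (nat \<lceil>1 - Re s\<rceil> + 1)"
      unfolding A_def by simp linarith
    thus ?thesis
      unfolding H_def using that eq by (metis linorder_le_cases)
  qed
  show ?thesis
  proof (rule that[of H])
    have "H holomorphic_on (\<Union>N\<in>UNIV. A N)"
    proof (rule holomorphic_on_UN_open)
      show "H holomorphic_on A N" for N
        using F[of N] by (rule holomorphic_transform) (simp add: H)
    qed (rule A)
    also have "(\<Union>N\<in>UNIV. A N) = UNIV"
    proof -
      have "s \<in> A (nat \<lceil>1 - Re s\<rceil> + 1)" for s
        unfolding A_def by simp linarith
      thus ?thesis by blast
    qed
    finally show "H holomorphic_on UNIV" .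
  qed (use FD in \<open>simp add: H_def\<close>)
qed

theorem zeta_characterization_ex1:
  "\<exists>!f. f holomorphic_on (- {1}) \<and>
        (\<forall>s. Re s > 1 \<longrightarrow> f s = (\<Sum>n. 1 / of_nat (Suc n) powr s)) \<and> f (1 :: complex) = (0 :: complex)"
proof -
  obtain H where H: "H holomorphic_on UNIV" "\<And>s. Re s > 1 \<Longrightarrow> H s = (s - 1) * zeta_tail s"
    using zeta_tail_entire by blast
  define f where "f s = (if s = 1 then 0 else 1 + H s / (s - 1))" for s
  have f_hol: "f holomorphic_on (- {1})"
  proof -
    have "(\<lambda>s. 1 + H s / (s - 1)) holomorphic_on (- {1})"
      using H(1) by (intro holomorphic_intros) (auto intro: holomorphic_on_subset)
    thus ?thesis
      by (rule holomorphic_transform) (simp add: f_def)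
  qed
  have f_series: "f s = (\<Sum>n. 1 / of_nat (Suc n) powr s)" if s: "Re s > 1" for s
  proof -
    from s have "s \<noteq> 1" by auto
    hence "f s = 1 + zeta_tail s" using s by (simp add: f_def H)
    moreover have "(\<lambda>n. 1 / of_nat (Suc n) powr s) sums (1 + zeta_tail s)"
    proof -
      have "(\<lambda>n. 1 / of_nat (Suc (Suc n)) powr s) sums zeta_tail s"
        using summable_sums[OF summable_nat_powr[OF s]]
        by (simp add: zeta_tail_def powr_minus field_simps add_ac)
      thus ?thesis by (subst (asm) sums_Suc_iff) (simp add: add_ac)
    qed
    ultimately show ?thesis by (simp add: sums_iff)
  qed
  show ?thesis
  proof (rule ex1I[of _ f], safe)
    show "f holomorphic_on (- {1})" by (rule f_hol)
    show "f 1 = 0" by (simp add: f_def)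
    show "f s = (\<Sum>n. 1 / of_nat (Suc n) powr s)" if "Re s > 1" for s
      using that by (rule f_series)
  next
    fix g :: "complex \<Rightarrow> complex"
    assume g: "g holomorphic_on - {1}" "g 1 = 0"
      "\<forall>s. Re s > 1 \<longrightarrow> g s = (\<Sum>n. 1 / of_nat (Suc n) powr s)"
    show "g = f"
    proof
      fix s
      show "g s = f s"
      proof (cases "s = 1")
        case False
        show ?thesis
        proof (rule analytic_continuation_open[of "{s. Re s > 1}" "- {1}" g f])
          show "{s. Re s > 1} \<noteq> {}" by (auto intro: exI[of _ 2])
          show "connected (- {1 :: complex})"
            by (rule connected_punctured_universe) simp
          show "g z = f z" if "z \<in> {s. Re s > 1}" for z
            using that g(3) f_series by simp
        qed (use False g(1) f_hol in \<open>auto simp: open_halfspace_Re_gt\<close>)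
      qed (simp add: g f_def)
    qed
  qed
qed

corollary zeta_holomorphic: "zeta holomorphic_on (- {1})"
  and zeta_eq_suminf: "Re s > 1 \<Longrightarrow> zeta s = (\<Sum>n. 1 / of_nat (Suc n) powr s)"
  and zeta_1: "zeta 1 = 0"
  using theI'[OF zeta_characterization_ex1] unfolding zeta_def by blast+

end

theory Submission
  imports Defs
begin

text \<open>
  On the half-plane \<open>Re s > 0\<close>, trapezoidal summation of \<open>x powr (- s)\<close> over \<open>{1..}\<close> gives
  \<open>zeta s = 1 / 2 + 1 / (s - 1) + R s\<close>. The error on \<open>{n..n + 1}\<close> is the integral of
  \<open>(n + 1 / 2 - x) * s * x powr (- s - 1)\<close>, and \<open>\<bar>n + 1 / 2 - x\<bar> \<le> 1 / 2\<close>, so that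
  \<open>norm (R s) \<le> norm s / (2 * \<sigma>) \<le> 1 / 2 + t / (2 * \<sigma>)\<close>. It remains that
  \<open>1 / norm (s - 1) \<le> 1 / t \<le> t / (2 * \<sigma>)\<close>, which holds because \<open>t\<^sup>2 \<ge> 4 \<ge> 2 * \<sigma>\<close>.
\<close>

text \<open>The integral of \<open>x powr (- s)\<close> is entered through its antiderivative
  \<open>- x powr (1 - s) / (s - 1)\<close>, so subtracting it gives a plus sign. Holomorphy away
  from 1 is then immediate, and the second summand telescopes in \<open>n\<close>.\<close>

definition trapezoid_error :: "nat \<Rightarrow> complex \<Rightarrow> complex" where
  "trapezoid_error n s = (of_nat (Suc n) powr (- s) + of_nat n powr (- s)) / 2
     + (of_nat (Suc n) powr (1 - s) - of_nat n powr (1 - s)) / (s - 1)"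

text \<open>The error is the increment over \<open>{n..n + 1}\<close> of a function whose derivative
  is dominated by that of a real function, so a mean value inequality replaces the integral. A free
  \<open>d \<le> Re s\<close> instead of \<open>Re s\<close> itself makes the bound uniform on
  discs, and its differences telescope in \<open>n\<close>.\<close>

lemma norm_trapezoid_error_le:
  assumes n: "n > 0" and d: "0 < d" "d \<le> Re s" and s1: "s \<noteq> 1"
  shows "norm (trapezoid_error n s)
    \<le> norm s / (2 * d) * (real n powr (- d) - real (Suc n) powr (- d))"
proof -
  \<comment> \<open>Integration by parts dictates this choice: the linear factor is 1/2 and -1/2 at
    the two ends, which yields the trapezoidal average. In the derivative, the two terms in
    \<open>x powr (- s)\<close> cancel because \<open>(1 - s) / (s - 1) = -1\<close>.\<close>
  define f where "f x = complex_of_real (x - real n - 1 / 2) * of_real x powr (- s)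
      + of_real x powr (1 - s) / (s - 1)" for x
  define f' where "f' x = - s * complex_of_real (x - real n - 1 / 2) * of_real x powr (- s - 1)" for x
  define g where "g x = - (norm s / (2 * d)) * x powr (- d)" for x :: real
  define g' where "g' x = norm s / 2 * x powr (- d - 1)" for x :: real
  have df: "(f has_vector_derivative f' x) (at x)" if "x \<ge> real n" for x
  proof -
    have x: "x > 0" using that n by linarith
    have "(1 - s) / (s - 1) = -1"
      using s1 by (simp add: divide_eq_eq)
    hence f'_eq: "f' x = 1 * of_real x powr (- s)
        + (- s * of_real x powr (- s - 1)) * (of_real x - of_nat n - 1 / 2)
        + (1 - s) * of_real x powr (1 - s - 1) / (s - 1)"
      unfolding f'_def times_divide_eq_left[symmetric] by simp
    have pow: "((\<lambda>z. z powr a) has_field_derivative a * of_real x powr (a - 1))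
        (at (of_real x))" for a :: complex
      using x by (intro has_field_derivative_powr) simp
    have lin: "((\<lambda>z. z - of_nat n - 1 / 2) has_field_derivative 1) (at (complex_of_real x))"
      by (auto intro!: derivative_eq_intros)
    have "((\<lambda>z. (z - of_nat n - 1 / 2) * z powr (- s) + z powr (1 - s) / (s - 1))
        has_field_derivative f' x) (at (of_real x))"
      using DERIV_add[OF DERIV_mult[OF lin pow[of "- s"]] DERIV_cdivide[OF pow[of "1 - s"]]]
      unfolding f'_eq .
    from has_vector_derivative_real_field[OF this] show ?thesis
      by (simp add: f_def[abs_def])
  qed
  have dg: "(g has_vector_derivative g' x) (at x)" if "x \<ge> real n" for x
    unfolding has_real_derivative_iff_has_vector_derivative[symmetric] g_def g'_def
    using that n d by (auto intro!: derivative_eq_intros)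
  have "norm (f (real (Suc n)) - f (real n)) \<le> g (real (Suc n)) - g (real n)"
  proof (rule differentiable_bound_general)
    show "continuous_on {real n..real (Suc n)} f" "continuous_on {real n..real (Suc n)} g"
      using df dg by (auto intro!: continuous_at_imp_continuous_on has_vector_derivative_continuous)
    fix x assume x: "real n < x" "x < real (Suc n)"
    show "(f has_vector_derivative f' x) (at x)" "(g has_vector_derivative g' x) (at x)"
      using df dg x by auto
    have "norm (of_real x powr (- s - 1)) = x powr (- Re s - 1)"
      using x n norm_powr_real_powr[of "of_real x" "- s - 1"] by simp
    \<comment> \<open>Here \<open>x > n \<ge> 1\<close>, so the larger exponent gives the larger
      power.\<close>
    also have "\<dots> \<le> x powr (- d - 1)"
      using x n d by (intro powr_mono) auto
    finally have p: "norm (of_real x powr (- s - 1)) \<le> x powr (- d - 1)" .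
    have "\<bar>x - real n - 1 / 2\<bar> \<le> 1 / 2"
      using x by (simp add: abs_if)
    hence "norm (f' x) \<le> norm s * (1 / 2) * x powr (- d - 1)"
      unfolding f'_def norm_mult norm_minus_cancel norm_of_real real_norm_def
      by (intro mult_mono p order_refl) auto
    thus "norm (f' x) \<le> g' x" by (simp add: g'_def)
  qed simp
  moreover have "f (real (Suc n)) - f (real n) = trapezoid_error n s"
  proof -
    have "real (Suc n) - real n - 1 / 2 = 1 / 2" "real n - real n - 1 / 2 = - (1 / 2)"
      by simp_all
    thus ?thesis
      unfolding f_def trapezoid_error_def
      by (simp only: of_real_minus of_real_divide of_real_1 of_real_numeral of_real_of_nat_eq
        diff_divide_distrib add_divide_distrib) simp
  qed
  ultimately show ?thesis by (simp add: g_def algebra_simps)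
qed

lemma powr_diff_sums:
  assumes "d > 0"
  shows "(\<lambda>n. real (Suc n) powr (- d) - real (Suc (Suc n)) powr (- d)) sums 1"
proof -
  have "(\<lambda>n. real (Suc n) powr (- d)) \<longlonglongrightarrow> 0"
    using assms by real_asymp
  from telescope_sums'[OF this] show ?thesis by simp
qed

text \<open>The telescoping majorant, with \<open>d\<close> fixed on a small disc around each point,
  gives locally uniform convergence by the Weierstrass test.\<close>

lemma suminf_trapezoid_error_holomorphic:
  "(\<lambda>s. \<Sum>n. trapezoid_error (Suc n) s) holomorphic_on ({s. Re s > 0} - {1})"
proof (rule holomorphic_uniform_sequence[where f = "\<lambda>N s. \<Sum>n<N. trapezoid_error (Suc n) s"])
  show op: "open ({s. Re s > 0} - {1})"
    by (intro open_delete open_halfspace_Re_gt)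
  show "(\<lambda>s. \<Sum>n<N. trapezoid_error (Suc n) s) holomorphic_on ({s. Re s > 0} - {1})" for N
    unfolding trapezoid_error_def by (intro holomorphic_intros) auto
  fix x :: complex assume x: "x \<in> {s. Re s > 0} - {1}"
  then obtain e where e: "e > 0" "cball x e \<subseteq> {s. Re s > 0} - {1}"
    using op open_contains_cball by blast
  \<comment> \<open>The bound \<open>e\<close> keeps the disc away from 1, and
    \<open>Re x / 2\<close> keeps \<open>Re s \<ge> d\<close> on it.\<close>
  define r where "r = min e (Re x / 2)"
  define d where "d = Re x / 2"
  have r: "r > 0" and d: "d > 0" and sub: "cball x r \<subseteq> {s. Re s > 0} - {1}"
    using x e by (auto simp: r_def d_def)
  have "uniform_limit (cball x r) (\<lambda>N s. \<Sum>n<N. trapezoid_error (Suc n) s)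
          (\<lambda>s. \<Sum>n. trapezoid_error (Suc n) s) sequentially"
  proof (rule Weierstrass_m_test)
    fix n s assume s: "s \<in> cball x r"
    have "Re x - Re s \<le> r"
      using s abs_Re_le_cmod[of "x - s"] by (simp add: dist_norm)
    hence ds: "d \<le> Re s" by (simp add: d_def r_def)
    have ns: "norm s \<le> norm x + r"
      using s norm_triangle_ineq2[of s x] by (simp add: dist_norm norm_minus_commute)
    have "norm (trapezoid_error (Suc n) s)
        \<le> norm s / (2 * d) * (real (Suc n) powr (- d) - real (Suc (Suc n)) powr (- d))"
      using s sub d ds by (intro norm_trapezoid_error_le) auto
    also have "\<dots> \<le> (norm x + r) / (2 * d)
        * (real (Suc n) powr (- d) - real (Suc (Suc n)) powr (- d))"
      using ns d by (intro mult_right_mono divide_right_mono) (auto intro!: powr_mono2')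
    finally show "norm (trapezoid_error (Suc n) s) \<le> \<dots>" .
  next
    show "summable (\<lambda>n. (norm x + r) / (2 * d)
        * (real (Suc n) powr (- d) - real (Suc (Suc n)) powr (- d)))"
      using powr_diff_sums[OF d] by (intro summable_mult) (rule sums_summable)
  qed
  with r sub show "\<exists>d>0. cball x d \<subseteq> {s. Re s > 0} - {1} \<and>
      uniform_limit (cball x d) (\<lambda>N s. \<Sum>n<N. trapezoid_error (Suc n) s)
          (\<lambda>s. \<Sum>n. trapezoid_error (Suc n) s) sequentially"
    by blast
qed

lemma trapezoid_error_sums:
  assumes "Re s > 1"
  shows "(\<lambda>n. trapezoid_error (Suc n) s) sums (zeta s - 1 / 2 - 1 / (s - 1))"
proof -
  have "summable (\<lambda>n. 1 / of_nat (Suc (Suc n)) powr s)"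
    using summable_nat_powr[OF assms] by (simp add: powr_minus field_simps)
  hence "summable (\<lambda>n. 1 / of_nat (Suc n) powr s)"
    by (subst (asm) summable_Suc_iff)
  hence z: "(\<lambda>n. 1 / of_nat (Suc n) powr s) sums zeta s"
    unfolding zeta_eq_suminf[OF assms] by (rule summable_sums)
  hence z': "(\<lambda>n. 1 / of_nat (Suc (Suc n)) powr s) sums (zeta s - 1)"
    by (subst sums_Suc_iff) simp
  have lim: "(\<lambda>n. of_nat (Suc n) powr (1 - s) :: complex) \<longlonglongrightarrow> 0"
  proof (rule tendsto_norm_zero_cancel)
    have "(\<lambda>n. real (Suc n) powr (1 - Re s)) \<longlonglongrightarrow> 0"
      using assms by real_asymp
    also have "(\<lambda>n. real (Suc n) powr (1 - Re s))
        = (\<lambda>n. norm (of_nat (Suc n) powr (1 - s) :: complex))"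
      using norm_powr_real_powr[of "of_nat (Suc n)" "1 - s" for n] by (simp add: fun_eq_iff)
    finally show "\<dots> \<longlonglongrightarrow> 0" .
  qed
  \<comment> \<open>The right endpoints miss the first term of the series, whence
    \<open>zeta s - 1\<close>. The antiderivative part telescopes from 1 at the first node to the
    limit 0.\<close>
  have "(\<lambda>n. (1 / of_nat (Suc (Suc n)) powr s + 1 / of_nat (Suc n) powr s) / 2
        + (of_nat (Suc (Suc n)) powr (1 - s) - of_nat (Suc n) powr (1 - s)) / (s - 1))
      sums ((zeta s - 1 + zeta s) / 2 + (0 - of_nat (Suc 0) powr (1 - s)) / (s - 1))"
    by (intro sums_add sums_divide z z' telescope_sums lim)
  also have "(zeta s - 1 + zeta s) / 2 + (0 - of_nat (Suc 0) powr (1 - s)) / (s - 1)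
      = zeta s - 1 / 2 - 1 / (s - 1)"
    by (simp add: field_simps)
  finally show ?thesis
    by (simp only: trapezoid_error_def powr_minus inverse_eq_divide)
qed

text \<open>Both sides are holomorphic on the punctured half-plane, which is connected, and the
  series computation identifies them for \<open>Re s > 1\<close>.\<close>

lemma zeta_eq_trapezoid:
  assumes "Re s > 0" "s \<noteq> 1"
  shows "zeta s = 1 / 2 + 1 / (s - 1) + (\<Sum>n. trapezoid_error (Suc n) s)"
proof (rule analytic_continuation_open[of "{s. Re s > 1}" "{s. Re s > 0} - {1}" zeta])
  show "{s. Re s > 1} \<noteq> {}" by (auto intro: exI[of _ 2])
  show "connected ({s. Re s > 0} - {1 :: complex})"
    by (intro connected_open_delete open_halfspace_Re_gt convex_connected convex_halfspace_Re_gt) simp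
  show "open ({s. Re s > 0} - {1 :: complex})"
    by (intro open_delete open_halfspace_Re_gt)
  show "zeta holomorphic_on ({s. Re s > 0} - {1})"
    by (rule holomorphic_on_subset[OF zeta_holomorphic]) auto
  show "(\<lambda>s. 1 / 2 + 1 / (s - 1) + (\<Sum>n. trapezoid_error (Suc n) s))
      holomorphic_on ({s. Re s > 0} - {1})"
    by (intro holomorphic_intros suminf_trapezoid_error_holomorphic) auto
  show "zeta z = 1 / 2 + 1 / (z - 1) + (\<Sum>n. trapezoid_error (Suc n) z)"
    if "z \<in> {s. Re s > 1}" for z
    using trapezoid_error_sums[of z] that by (simp add: sums_iff)
qed (use assms in \<open>auto simp: open_halfspace_Re_gt\<close>)

text \<open>With \<open>s\<close> fixed, the termwise bound can be taken at its extreme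
  \<open>d = Re s\<close>, and the differences of powers then sum to 1.\<close>

lemma norm_suminf_trapezoid_error_le:
  assumes "Re s > 0" "s \<noteq> 1"
  shows "norm (\<Sum>n. trapezoid_error (Suc n) s) \<le> norm s / (2 * Re s)"
proof -
  have sums: "(\<lambda>n. norm s / (2 * Re s)
      * (real (Suc n) powr (- Re s) - real (Suc (Suc n)) powr (- Re s))) sums (norm s / (2 * Re s) * 1)"
    by (intro sums_mult powr_diff_sums assms)
  have "norm (\<Sum>n. trapezoid_error (Suc n) s) \<le> (\<Sum>n. norm s / (2 * Re s)
      * (real (Suc n) powr (- Re s) - real (Suc (Suc n)) powr (- Re s)))"
    using assms by (intro norm_suminf_le norm_trapezoid_error_le sums_summable[OF sums]) auto
  thus ?thesis using sums by (simp add: sums_iff)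
qed

theorem proposition8:
  fixes \<sigma> t :: real and s :: complex
  assumes "s = Complex \<sigma> t"
    and "0 < \<sigma>" and "\<sigma> \<le> 2" and "t \<ge> 2"
  shows "norm (zeta s) \<le> 1 + t / \<sigma>"
proof -
  have s: "Re s = \<sigma>" "Im s = t" and s1: "s \<noteq> 1"
    using assms by (auto simp: complex_eq_iff)
  have "t \<le> norm (s - 1)"
    using abs_Im_le_cmod[of "s - 1"] s by simp
  hence "norm (1 / (s - 1)) \<le> 1 / t"
    using assms(4) by (simp add: norm_divide frac_le)
  also have "\<dots> \<le> t / (2 * \<sigma>)"
    using assms(2-4) mult_mono[of 2 t 2 t] by (simp add: field_simps)
  finally have pole: "norm (1 / (s - 1)) \<le> t / (2 * \<sigma>)" .
  have "norm s \<le> \<sigma> + t"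
    using cmod_le[of s] s assms(2,4) by simp
  hence "norm s / (2 * \<sigma>) \<le> 1 / 2 + t / (2 * \<sigma>)"
    using assms(2) by (simp add: field_simps)
  hence err: "norm (\<Sum>n. trapezoid_error (Suc n) s) \<le> 1 / 2 + t / (2 * \<sigma>)"
    using norm_suminf_trapezoid_error_le[of s] s s1 assms(2) by simp
  have "norm (zeta s)
      \<le> norm (1 / 2 :: complex) + norm (1 / (s - 1)) + norm (\<Sum>n. trapezoid_error (Suc n) s)"
    using zeta_eq_trapezoid[of s] s s1 assms(2)
    by (auto intro!: norm_triangle_le add_mono norm_triangle_ineq)
  also have "\<dots> \<le> 1 / 2 + t / (2 * \<sigma>) + (1 / 2 + t / (2 * \<sigma>))"
    by (intro add_mono pole err) simp
  also have "\<dots> = 1 + t / \<sigma>" using assms(2) by (simp add: field_simps)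
  finally show ?thesis .
qed

end
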